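(* Let $X$ be a Kähler manifold and let $\alpha=\sum_{k\ge1}\hbar^k\omega_k$ be a closed formal $2$-form on $X$. The solution $I\in\mathcal{A}^1_X(\mathcal{W}_{X,\mathbb{C}})$ of the Fedosov equation $$\nabla I-\delta I+\frac1\hbar I\star I+R_\nabla=\alpha$$ satisfying the two conditions $$(\delta^{1,0})^{-1}(I)=0,\qquad \pi_{0,*}(I)=0$$ is unique (i.e. there is at most one such solution).
   Context: **Kähler conventions.** Summation convention. $\omega=\omega_{\alpha\bar\beta}dz^\alpha\wedge d\bar z^\beta=\sqrt{-1}g_{\alpha\bar\beta}dz^\alpha\wedge d\bar z^\beta$ is the Kähler form, $\omega^{\bar\gamma\alpha}\omega_{\alpha\bar\beta}=\delta^{\bar\gamma}_{\bar\beta}$, $\omega^{\alpha\bar\beta}=-\omega^{\bar\beta\alpha}$. **Weyl bundle.** $\overline{\mathcal{W}}_X=\widehat{\mathrm{Sym}}(\overline{T^*X})[[\hbar]]$ and $\mathcal{W}_{X,\mathbb{C}}=\widehat{\mathrm{Sym}}(T^*X)[[\hbar]]\otimes\overline{\mathcal{W}}_X$; local sections are formal power series in $\hbar$, $y^i$ (frame of the holomorphic cotangent bundle) and $\bar y^j$ (frame of the anti-holomorphic cotangent bundle). $\delta=dz^i\wedge\partial_{y^i}+d\bar z^j\wedge\partial_{\bar y^j}$. $(\delta^{1,0})^{-1}a=\frac{1}{p_1+p_2}y^k\iota_{\partial_{z^k}}a$ if $a$ has form type $(p_1,q_1)$ and degree $p_2$ in the $y$'s (zero if $p_1+p_2=0$).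 $\pi_{0,*}:\mathcal{A}_X^\bullet(\mathcal{W}_{X,\mathbb{C}})\to\mathcal{A}_X^{0,\bullet}(\overline{\mathcal{W}}_X)$ is the natural projection (keeping exactly the terms containing no $dz^i$ and no $y^i$). Wick product: $a\star b=\sum_k\frac{\hbar^k}{k!}\omega^{i_1\bar j_1}\cdots\omega^{i_k\bar j_k}\partial_{y^{i_1}}\cdots\partial_{y^{i_k}}a\;\partial_{\bar y^{j_1}}\cdots\partial_{\bar y^{j_k}}b$, with form parts wedged. $\nabla$ is the Levi-Civita connection; $\nabla^2(y^m)=R_{i\bar jk}^mdz^i\wedge d\bar z^j\otimes y^k$, $R_{i\bar jk\bar l}=R_{i\bar jk}^mg_{m\bar l}$, $R_\nabla=\sqrt{-1}R_{i\bar jk\bar l}dz^i\wedge d\bar z^j\otimes y^k\bar y^l$. *)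

theory Defs
  imports
    "HOL-Analysis.Analysis"
    "HOL-Library.Function_Algebras"
    "HOL-Library.Poly_Mapping"
    "HOL-Computational_Algebra.Formal_Laurent_Series"
begin

section \<open>Calculus in holomorphic coordinates\<close>

primrec C_k_on :: "nat \<Rightarrow> 'b::real_normed_vector set \<Rightarrow> ('b \<Rightarrow> 'c::real_normed_vector) \<Rightarrow> bool" where
  "C_k_on 0 S f \<longleftrightarrow> continuous_on S f"
| "C_k_on (Suc k) S f \<longleftrightarrow> (\<forall>x\<in>S. f differentiable (at x)) \<and>
     (\<forall>v. C_k_on k S (\<lambda>x. frechet_derivative f (at x) v))"

text \<open>Real smoothness. The definition is only used on open sets.\<close>

definition smooth_on :: "'b::real_normed_vector set \<Rightarrow> ('b \<Rightarrow> 'c::real_normed_vector) \<Rightarrow> bool" where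
  "smooth_on S f \<longleftrightarrow> (\<forall>k. C_k_on k S f)"

text \<open>Holomorphy in several variables on an open set: the real derivative is complex linear
  at every point.\<close>

definition holomorphic_map_on :: "(complex^'n::finite) set \<Rightarrow> (complex^'n \<Rightarrow> complex^'n) \<Rightarrow> bool" where
  "holomorphic_map_on S f \<longleftrightarrow>
     (\<forall>z\<in>S. \<exists>J :: complex^'n^'n. (f has_derivative (\<lambda>v. J *v v)) (at z))"

text \<open>Indices of the complexified (co)tangent bundle: \<open>Inl i\<close> stands for the holomorphic direction
  \<open>z\<^sup>i\<close> and \<open>Inr j\<close> for the anti-holomorphic direction \<open>\<bar>z\<^sup>j\<close>; likewise for \<open>y\<^sup>i\<close> and \<open>\<bar>y\<^sup>j\<close>.\<close>

type_synonym 'n idx = "'n + 'n"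

fun zcoord :: "'n::finite idx \<Rightarrow> complex^'n \<Rightarrow> complex" where
  "zcoord (Inl i) z = z $ i"
| "zcoord (Inr j) z = cnj (z $ j)"

text \<open>Wirtinger derivatives.\<close>

fun wirt :: "'n::finite idx \<Rightarrow> (complex^'n \<Rightarrow> complex) \<Rightarrow> complex^'n \<Rightarrow> complex" where
  "wirt (Inl i) f z =
     (frechet_derivative f (at z) (axis i 1) - \<i> * frechet_derivative f (at z) (axis i \<i>)) / 2"
| "wirt (Inr j) f z =
     (frechet_derivative f (at z) (axis j 1) + \<i> * frechet_derivative f (at z) (axis j \<i>)) / 2"

section \<open>Exterior algebra\<close>

text \<open>A form at a point is given by its values on lists of coordinate vectors: the value on
  \<open>[c\<^sub>1, \<dots>, c\<^sub>p]\<close> is \<open>a(\<partial>\<^bsub>c\<^sub>1\<^esub>, \<dots>, \<partial>\<^bsub>c\<^sub>p\<^esub>)\<close>, i.e.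
  the \<open>p\<close>-form part of \<open>a\<close> is the sum of \<open>1/p! a(c\<^sub>1, \<dots>, c\<^sub>p) dz\<^bsup>c\<^sub>1\<^esup> \<and> \<dots> \<and> dz\<^bsup>c\<^sub>p\<^esup>\<close>
  over all lists of length \<open>p\<close>.\<close>

definition alternating :: "('i list \<Rightarrow> 'v::ab_group_add) \<Rightarrow> bool" where
  "alternating a \<longleftrightarrow>
     (\<forall>L i j. i < j \<and> j < length L \<longrightarrow> a (L[i := L ! j, j := L ! i]) = - a L)"

definition of_degree :: "nat \<Rightarrow> ('i list \<Rightarrow> 'v::ab_group_add) \<Rightarrow> bool" where
  "of_degree p a \<longleftrightarrow> (\<forall>L. length L \<noteq> p \<longrightarrow> a L = 0)"

text \<open>\<open>dz\<^sup>c \<and> a\<close>.\<close>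

definition dz_wedge :: "'i \<Rightarrow> ('i list \<Rightarrow> 'v::ab_group_add) \<Rightarrow> 'i list \<Rightarrow> 'v" where
  "dz_wedge c a L =
     (\<Sum>k | k < length L \<and> L ! k = c.
        if even k then a (take k L @ drop (Suc k) L) else - a (take k L @ drop (Suc k) L))"

definition contract :: "'i \<Rightarrow> ('i list \<Rightarrow> 'v) \<Rightarrow> 'i list \<Rightarrow> 'v" where
  "contract c a L = a (c # L)"

definition ext_d :: "(complex^'n::finite \<Rightarrow> 'n idx list \<Rightarrow> complex) \<Rightarrow> complex^'n \<Rightarrow> 'n idx list \<Rightarrow> complex" where
  "ext_d a z = (\<Sum>c\<in>UNIV. dz_wedge c (\<lambda>L. wirt c (\<lambda>w. a w L) z))"

section \<open>Complex manifolds and scalar forms\<close>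

type_synonym ('a, 'n) chart = "'a set \<times> ('a \<Rightarrow> complex^'n)"

definition chart_image :: "('a, 'n::finite) chart \<Rightarrow> (complex^'n) set" where
  "chart_image c = snd c ` fst c"

definition overlap :: "('a, 'n::finite) chart \<Rightarrow> ('a, 'n) chart \<Rightarrow> (complex^'n) set" where
  "overlap c c' = snd c ` (fst c \<inter> fst c')"

definition transition :: "('a, 'n::finite) chart \<Rightarrow> ('a, 'n) chart \<Rightarrow> complex^'n \<Rightarrow> complex^'n" where
  "transition c c' = snd c' \<circ> inv_into (fst c) (snd c)"

definition complex_manifold :: "'a topology \<Rightarrow> ('a, 'n::finite) chart set \<Rightarrow> bool" where
  "complex_manifold X A \<longleftrightarrow>
     Hausdorff_space X \<and> second_countable X \<and>
     (\<Union>c\<in>A. fst c) = topspace X \<and>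
     (\<forall>c\<in>A. openin X (fst c) \<and> open (chart_image c) \<and>
        homeomorphic_map (subtopology X (fst c)) (top_of_set (chart_image c)) (snd c)) \<and>
     (\<forall>c\<in>A. \<forall>c'\<in>A. holomorphic_map_on (overlap c c') (transition c c'))"

text \<open>Jacobian of the coordinate change in all \<open>2n\<close> complexified directions; for holomorphic
  transition maps it is block diagonal with conjugate blocks.\<close>

definition jac :: "('a, 'n::finite) chart \<Rightarrow> ('a, 'n) chart \<Rightarrow> complex^'n \<Rightarrow> 'n idx \<Rightarrow> 'n idx \<Rightarrow> complex" where
  "jac c c' z b a = wirt a (\<lambda>w. zcoord b (transition c c' w)) z"

definition jac_prod :: "('a, 'n::finite) chart \<Rightarrow> ('a, 'n) chart \<Rightarrow> complex^'n \<Rightarrow> 'n idx list \<Rightarrow> 'n idx list \<Rightarrow> complex" where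
  "jac_prod c c' z L' L = (\<Prod>k<length L. jac c c' z (L' ! k) (L ! k))"

text \<open>Global complex valued \<open>p\<close>-forms, given by their coordinate expression in every chart.
  Only the values on \<open>chart_image c\<close> for \<open>c \<in> A\<close> matter.\<close>

type_synonym ('a, 'n) form_field = "('a, 'n) chart \<Rightarrow> complex^'n \<Rightarrow> 'n idx list \<Rightarrow> complex"

definition smooth_form :: "('a, 'n::finite) chart set \<Rightarrow> nat \<Rightarrow> ('a, 'n) form_field \<Rightarrow> bool" where
  "smooth_form A p a \<longleftrightarrow>
     (\<forall>c\<in>A. \<forall>z\<in>chart_image c. alternating (a c z) \<and> of_degree p (a c z)) \<and>
     (\<forall>c\<in>A. \<forall>L. smooth_on (chart_image c) (\<lambda>z. a c z L)) \<and>
     (\<forall>c\<in>A. \<forall>c'\<in>A. \<forall>z\<in>overlap c c'. \<forall>L.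
        a c z L = (\<Sum>L' | length L' = length L. jac_prod c c' z L' L * a c' (transition c c' z) L'))"

definition closed_form :: "('a, 'n::finite) chart set \<Rightarrow> nat \<Rightarrow> ('a, 'n) form_field \<Rightarrow> bool" where
  "closed_form A p a \<longleftrightarrow> smooth_form A p a \<and> (\<forall>c\<in>A. \<forall>z\<in>chart_image c. ext_d (a c) z = 0)"

section \<open>Kaehler metrics\<close>

text \<open>A metric is given in every chart by the matrix \<open>g $ i $ j\<close> with entries
  \<open>g\<^bsub>i\<bar>j\<^esub>\<close>.\<close>

type_synonym ('a, 'n) metric_field = "('a, 'n) chart \<Rightarrow> complex^'n \<Rightarrow> complex^'n^'n"

definition hermitian_pos :: "complex^'n::finite^'n \<Rightarrow> bool" where
  "hermitian_pos h \<longleftrightarrow>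
     (\<forall>i j. h $ j $ i = cnj (h $ i $ j)) \<and>
     (\<forall>v::complex^'n. v \<noteq> 0 \<longrightarrow> Re (\<Sum>i\<in>UNIV. \<Sum>j\<in>UNIV. h $ i $ j * (v $ i) * cnj (v $ j)) > 0)"

text \<open>\<open>\<omega> = \<i> g\<^bsub>i\<bar>j\<^esub> dz\<^sup>i \<and> d\<bar>z\<^sup>j\<close>.\<close>

definition kaehler_form :: "complex^'n::finite^'n \<Rightarrow> 'n idx list \<Rightarrow> complex" where
  "kaehler_form h L =
     (\<Sum>i\<in>UNIV. \<Sum>j\<in>UNIV. \<i> * h $ i $ j *
        dz_wedge (Inl i) (dz_wedge (Inr j) (\<lambda>M. if M = [] then 1 else 0)) L)"

definition kaehler_manifold ::
    "'a topology \<Rightarrow> ('a, 'n::finite) chart set \<Rightarrow> ('a, 'n) metric_field \<Rightarrow> bool" where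
  "kaehler_manifold X A g \<longleftrightarrow>
     complex_manifold X A \<and>
     (\<forall>c\<in>A. \<forall>z\<in>chart_image c. hermitian_pos (g c z)) \<and>
     closed_form A 2 (\<lambda>c z. kaehler_form (g c z))"

text \<open>\<open>\<omega>\<^bsup>i\<bar>j\<^esup> = - \<omega>\<^bsup>\<bar>ji\<^esup>\<close>, where \<open>\<omega>\<^bsup>\<bar>ji\<^esup>\<close> is the inverse
  matrix of \<open>\<omega>\<^bsub>i\<bar>j\<^esub> = \<i> g\<^bsub>i\<bar>j\<^esub>\<close>.\<close>

definition omega_up :: "complex^'n::finite^'n \<Rightarrow> 'n \<Rightarrow> 'n \<Rightarrow> complex" where
  "omega_up h i j = - matrix_inv (\<chi> k l. \<i> * h $ k $ l) $ j $ i"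

text \<open>Complex bilinear extension of the Riemannian metric to the complexified tangent bundle.\<close>

fun cmetric :: "complex^'n::finite^'n \<Rightarrow> 'n idx \<Rightarrow> 'n idx \<Rightarrow> complex" where
  "cmetric h (Inl i) (Inr j) = h $ i $ j"
| "cmetric h (Inr j) (Inl i) = h $ i $ j"
| "cmetric h (Inl i) (Inl j) = 0"
| "cmetric h (Inr i) (Inr j) = 0"

text \<open>Christoffel symbols \<open>\<Gamma>\<^sup>e\<^bsub>ab\<^esub>\<close> of the Levi-Civita connection in the
  complexified coordinate frame: \<open>\<nabla>\<^sub>a \<partial>\<^sub>b = \<Gamma>\<^sup>e\<^bsub>ab\<^esub> \<partial>\<^sub>e\<close>.\<close>

definition christoffel ::
    "(complex^'n::finite \<Rightarrow> complex^'n^'n) \<Rightarrow> complex^'n \<Rightarrow> 'n idx \<Rightarrow> 'n idx \<Rightarrow> 'n idx \<Rightarrow> complex" where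
  "christoffel g z e a b =
     (1/2) * (\<Sum>d\<in>UNIV. matrix_inv (\<chi> k l. cmetric (g z) k l) $ e $ d *
        (wirt a (\<lambda>w. cmetric (g w) b d) z + wirt b (\<lambda>w. cmetric (g w) a d) z
           - wirt d (\<lambda>w. cmetric (g w) a b) z))"

section \<open>The Weyl bundle\<close>

text \<open>An element of a fibre of the complexified Weyl bundle is a formal power series in the \<open>y\<^sup>i\<close>
  and \<open>\<bar>y\<^sup>j\<close> whose coefficients are formal power series in \<open>\<hbar> = fps_X\<close>.\<close>

type_synonym 'n mono = "'n idx \<Rightarrow>\<^sub>0 nat"
type_synonym 'n weyl = "'n mono \<Rightarrow> complex fps"
type_synonym 'n weyl_form = "'n idx list \<Rightarrow> 'n weyl"

definition weyl_mult :: "'n weyl \<Rightarrow> 'n weyl \<Rightarrow> 'n weyl" where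
  "weyl_mult a b m = (\<Sum>(r, s) | r + s = m. a r * b s)"

definition dy :: "'n idx \<Rightarrow> 'n weyl \<Rightarrow> 'n weyl" where
  "dy c a m = of_nat (Poly_Mapping.lookup m c + 1) * a (m + Poly_Mapping.single c 1)"

definition ymult :: "'n idx \<Rightarrow> 'n weyl \<Rightarrow> 'n weyl" where
  "ymult c a m = (if Poly_Mapping.lookup m c = 0 then 0 else a (m - Poly_Mapping.single c 1))"

text \<open>The Wick product of a fibre, with \<open>w i j = \<omega>\<^bsup>i\<bar>j\<^esup>\<close>. The \<open>k\<close>-th summand is divisible by
  \<open>\<hbar>\<^sup>k\<close>, so that only \<open>k \<le> r\<close> contributes to the coefficient of \<open>\<hbar>\<^sup>r\<close>.\<close>

definition wick_term :: "('n \<Rightarrow> 'n \<Rightarrow> complex) \<Rightarrow> nat \<Rightarrow> 'n::finite weyl \<Rightarrow> 'n weyl \<Rightarrow> 'n weyl" where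
  "wick_term w k a b m =
     fps_const (1 / fact k) * fps_X ^ k *
       (\<Sum>is | length is = k. \<Sum>js | length js = k.
          fps_const (\<Prod>t<k. w (is ! t) (js ! t)) *
          weyl_mult (foldr dy (map Inl is) a) (foldr dy (map Inr js) b) m)"

definition wick :: "('n \<Rightarrow> 'n \<Rightarrow> complex) \<Rightarrow> 'n::finite weyl \<Rightarrow> 'n weyl \<Rightarrow> 'n weyl" where
  "wick w a b m = Abs_fps (\<lambda>r. \<Sum>k\<le>r. fps_nth (wick_term w k a b m) r)"

text \<open>Wick product of Weyl bundle valued forms: form parts are wedged, the sum being over all
  shuffles, each with its sign.\<close>

definition wick_form :: "('n \<Rightarrow> 'n \<Rightarrow> complex) \<Rightarrow> 'n::finite weyl_form \<Rightarrow> 'n weyl_form \<Rightarrow> 'n weyl_form" where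
  "wick_form w a b L =
     (\<Sum>S\<in>Pow {..<length L}.
        let p = wick w (a (nths L S)) (b (nths L ({..<length L} - S)))
        in if even (card {(i, j). i \<in> S \<and> j \<in> {..<length L} - S \<and> j < i}) then p else - p)"

definition delta :: "'n::finite weyl_form \<Rightarrow> 'n weyl_form" where
  "delta a = (\<Sum>c\<in>UNIV. dz_wedge c (\<lambda>L. dy c (a L)))"

definition holo_form_degree :: "'n idx list \<Rightarrow> nat" where
  "holo_form_degree L = length (filter isl L)"

definition y_degree :: "'n::finite mono \<Rightarrow> nat" where
  "y_degree m = (\<Sum>i\<in>UNIV. Poly_Mapping.lookup m (Inl i))"

text \<open>\<open>(\<delta>\<^bsup>1,0\<^esup>)\<^sup>-\<^sup>1\<close>: every bihomogeneous component is first divided by \<open>p\<^sub>1 + p\<^sub>2\<close>; the component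
  with \<open>p\<^sub>1 + p\<^sub>2 = 0\<close> is sent to zero because of \<open>1 / 0 = 0\<close>.\<close>

definition delta10_inv :: "'n::finite weyl_form \<Rightarrow> 'n weyl_form" where
  "delta10_inv a =
     (\<Sum>k\<in>UNIV. (\<lambda>L. ymult (Inl k)
        (contract (Inl k)
          (\<lambda>M m. fps_const (1 / of_nat (holo_form_degree M + y_degree m)) * a M m) L)))"

definition pi0 :: "'n::finite weyl_form \<Rightarrow> 'n weyl_form" where
  "pi0 a L m = (if holo_form_degree L = 0 \<and> y_degree m = 0 then a L m else 0)"

text \<open>The Levi-Civita connection on the Weyl bundle, \<open>\<nabla>\<^sub>c y\<^sup>e = - \<Gamma>\<^sup>e\<^bsub>cb\<^esub> y\<^sup>b\<close>, extended as a
  derivation, and its extension to forms.\<close>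

definition cov_deriv ::
    "(complex^'n::finite \<Rightarrow> complex^'n^'n) \<Rightarrow> 'n idx \<Rightarrow> (complex^'n \<Rightarrow> 'n weyl) \<Rightarrow> complex^'n \<Rightarrow> 'n weyl" where
  "cov_deriv g c s z m =
     Abs_fps (\<lambda>r. wirt c (\<lambda>w. fps_nth (s w m) r) z)
     - (\<Sum>e\<in>UNIV. \<Sum>b\<in>UNIV. fps_const (christoffel g z e c b) * ymult b (dy e (s z)) m)"

definition nabla ::
    "(complex^'n::finite \<Rightarrow> complex^'n^'n) \<Rightarrow> (complex^'n \<Rightarrow> 'n weyl_form) \<Rightarrow> complex^'n \<Rightarrow> 'n weyl_form" where
  "nabla g a z = (\<Sum>c\<in>UNIV. dz_wedge c (\<lambda>L. cov_deriv g c (\<lambda>w. a w L) z))"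

definition monomial_form :: "'n mono \<Rightarrow> 'n weyl_form" where
  "monomial_form m L k = (if L = [] \<and> k = m then 1 else 0)"

text \<open>\<open>R\<^bsub>i\<bar>jk\<^esub>\<^sup>m\<close>, read off from \<open>\<nabla>\<^sup>2(y\<^sup>m) = R\<^bsub>i\<bar>jk\<^esub>\<^sup>m dz\<^sup>i \<and> d\<bar>z\<^sup>j \<otimes> y\<^sup>k\<close>, and
  \<open>R\<^bsub>i\<bar>jk\<bar>l\<^esub> = R\<^bsub>i\<bar>jk\<^esub>\<^sup>m g\<^bsub>m\<bar>l\<^esub>\<close>.\<close>

definition curv :: "(complex^'n::finite \<Rightarrow> complex^'n^'n) \<Rightarrow> complex^'n \<Rightarrow> 'n \<Rightarrow> 'n \<Rightarrow> 'n \<Rightarrow> 'n \<Rightarrow> complex" where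
  "curv g z i j k m =
     fps_nth (nabla g (nabla g (\<lambda>w. monomial_form (Poly_Mapping.single (Inl m) 1))) z
       [Inl i, Inr j] (Poly_Mapping.single (Inl k) 1)) 0"

definition curv_low :: "(complex^'n::finite \<Rightarrow> complex^'n^'n) \<Rightarrow> complex^'n \<Rightarrow> 'n \<Rightarrow> 'n \<Rightarrow> 'n \<Rightarrow> 'n \<Rightarrow> complex" where
  "curv_low g z i j k l = (\<Sum>m\<in>UNIV. curv g z i j k m * g z $ m $ l)"

definition R_nabla :: "(complex^'n::finite \<Rightarrow> complex^'n^'n) \<Rightarrow> complex^'n \<Rightarrow> 'n weyl_form" where
  "R_nabla g z L m =
     (\<Sum>i\<in>UNIV. \<Sum>j\<in>UNIV. \<Sum>k\<in>UNIV. \<Sum>l\<in>UNIV. fps_const (\<i> * curv_low g z i j k l) *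
        dz_wedge (Inl i) (dz_wedge (Inr j)
          (monomial_form (Poly_Mapping.single (Inl k) 1 + Poly_Mapping.single (Inr l) 1))) L m)"

section \<open>Global sections and the Fedosov equation\<close>

text \<open>Coordinate change of the fibre variables. If \<open>y'\<^sup>b = \<Sum>\<^sub>a J\<^sup>b\<^sub>a y\<^sup>a\<close>, then \<open>subst_coeff J r m\<close> is the
  coefficient of \<open>y\<^sup>m\<close> in \<open>y'\<^sup>r\<close>.\<close>

definition subst_coeff :: "('n::finite idx \<Rightarrow> 'n idx \<Rightarrow> complex) \<Rightarrow> 'n mono \<Rightarrow> 'n mono \<Rightarrow> complex" where
  "subst_coeff J r m =
     Poly_Mapping.lookup (\<Prod>b\<in>UNIV. (\<Sum>a\<in>UNIV. Poly_Mapping.single (Poly_Mapping.single a 1) (J b a)) ^ Poly_Mapping.lookup r b) m"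

definition total_degree :: "'n::finite mono \<Rightarrow> nat" where
  "total_degree m = (\<Sum>c\<in>UNIV. Poly_Mapping.lookup m c)"

type_synonym ('a, 'n) weyl_field = "('a, 'n) chart \<Rightarrow> complex^'n \<Rightarrow> 'n weyl_form"

text \<open>Smooth \<open>p\<close>-forms with values in the Weyl bundle. The coordinate expressions are normalised to
  be zero outside the charts, so that the elements of this set correspond bijectively to
  sections.\<close>

definition weyl_forms :: "('a, 'n::finite) chart set \<Rightarrow> nat \<Rightarrow> ('a, 'n) weyl_field set" where
  "weyl_forms A p = {a.
     (\<forall>c z. \<not> (c \<in> A \<and> z \<in> chart_image c) \<longrightarrow> a c z = 0) \<and>
     (\<forall>c\<in>A. \<forall>z\<in>chart_image c. alternating (a c z) \<and> of_degree p (a c z)) \<and>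
     (\<forall>c\<in>A. \<forall>L m r. smooth_on (chart_image c) (\<lambda>z. fps_nth (a c z L m) r)) \<and>
     (\<forall>c\<in>A. \<forall>c'\<in>A. \<forall>z\<in>overlap c c'. \<forall>L m.
        a c z L m =
          (\<Sum>L' | length L' = length L. \<Sum>s | total_degree s = total_degree m.
             fps_const (jac_prod c c' z L' L * subst_coeff (jac c c' z) s m) *
             a c' (transition c c' z) L' s))}"

text \<open>The formal form \<open>\<Sum>\<^bsub>k\<ge>1\<^esub> \<hbar>\<^sup>k \<omega>\<^sub>k\<close>.\<close>

definition formal_form :: "(nat \<Rightarrow> ('a, 'n) form_field) \<Rightarrow> ('a, 'n) weyl_field" where
  "formal_form \<omega> c z L m =
     (if m = 0 then Abs_fps (\<lambda>k. if k \<ge> 1 then \<omega> k c z L else 0) else 0)"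

text \<open>\<open>\<nabla>I - \<delta>I + 1/\<hbar> I \<star> I + R\<^sub>\<nabla> = \<alpha>\<close>. Because of the factor \<open>1/\<hbar>\<close> the equation is stated for Laurent
  series in \<open>\<hbar>\<close>.\<close>

definition fedosov_equation ::
    "('a, 'n::finite) chart set \<Rightarrow> ('a, 'n) metric_field \<Rightarrow> ('a, 'n) weyl_field \<Rightarrow> ('a, 'n) weyl_field \<Rightarrow> bool" where
  "fedosov_equation A g \<alpha> I \<longleftrightarrow>
     (\<forall>c\<in>A. \<forall>z\<in>chart_image c. \<forall>L m.
        fps_to_fls (nabla (g c) (I c) z L m) - fps_to_fls (delta (I c z) L m)
        + fls_X_inv * fps_to_fls (wick_form (omega_up (g c z)) (I c z) (I c z) L m)
        + fps_to_fls (R_nabla (g c) z L m)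
        = fps_to_fls (\<alpha> c z L m))"

end

theory Submission
  imports Defs
begin

text \<open>Let \<open>I\<close> and \<open>J\<close> be two solutions and \<open>D = I - J\<close>. Give \<open>y\<^sup>i\<close> and \<open>\<hbar>\<close> weight one and \<open>\<bar>y\<^sup>j\<close> weight zero.
  The Hodge decomposition of \<open>\<delta>\<^bsup>1,0\<^esup>\<close> and the two gauge conditions express \<open>D\<close> as
  \<open>(\<delta>\<^bsup>1,0\<^esup>)\<^sup>-\<^sup>1\<close> of \<open>\<nabla>D - \<delta>\<^bsup>0,1\<^esup>D + 1/\<hbar> (I \<star> D + D \<star> J)\<close>. The connection preserves the weight because
  the mixed Christoffel symbols of a Kaehler metric vanish, and \<open>\<delta>\<^bsup>0,1\<^esup>\<close> only removes a \<open>\<bar>y\<^sup>j\<close>. The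
  gauge conditions kill all terms of \<open>I\<close> and \<open>J\<close> without \<open>y\<^sup>i\<close>, which compensates \<open>1/\<hbar>\<close>.
  Since \<open>(\<delta>\<^bsup>1,0\<^esup>)\<^sup>-\<^sup>1\<close> raises the weight by one, \<open>D\<close> vanishes in every weight. The induction is
  phrased as agreement of \<open>I\<close> and \<open>J\<close> in low weights on a whole chart, which
  avoids any use of linearity of \<open>\<nabla>\<close>.\<close>

section \<open>Christoffel symbols of a Kaehler metric\<close>

lemma sum_UNIV_Plus:
  fixes f :: "'n::finite + 'm::finite \<Rightarrow> 'v::comm_monoid_add"
  shows "sum f UNIV = (\<Sum>i\<in>UNIV. f (Inl i)) + (\<Sum>j\<in>UNIV. f (Inr j))"
  by (simp add: sum.Plus flip: UNIV_Plus_UNIV)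

text \<open>Pairing the vanishing sums with \<open>cnj (v $ j)\<close> gives the Hermitian form at
  \<open>v\<close>, which is positive unless \<open>v = 0\<close>.\<close>

lemma hermitian_pos_left_kernel:
  fixes h :: "complex^'n::finite^'n"
  assumes "hermitian_pos h" and "\<And>j. (\<Sum>i\<in>UNIV. h $ i $ j * v $ i) = 0"
  shows "v = 0"
proof (rule ccontr)
  assume "v \<noteq> 0"
  then have "Re (\<Sum>i\<in>UNIV. \<Sum>j\<in>UNIV. h $ i $ j * (v $ i) * cnj (v $ j)) > 0"
    using assms(1) unfolding hermitian_pos_def by blast
  also have "(\<Sum>i\<in>UNIV. \<Sum>j\<in>UNIV. h $ i $ j * (v $ i) * cnj (v $ j))
      = (\<Sum>j\<in>UNIV. (\<Sum>i\<in>UNIV. h $ i $ j * (v $ i)) * cnj (v $ j))"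
    by (subst sum.swap) (simp add: sum_distrib_right)
  also have "\<dots> = 0" using assms(2) by simp
  finally show False by simp
qed

lemma hermitian_pos_right_kernel:
  fixes h :: "complex^'n::finite^'n"
  assumes "hermitian_pos h" and "\<And>i. (\<Sum>j\<in>UNIV. h $ i $ j * v $ j) = 0"
  shows "v = 0"
proof -
  have *: "h $ j $ i = cnj (h $ i $ j)" for i j
    using assms(1) unfolding hermitian_pos_def by blast
  have "(\<chi> i. cnj (v $ i)) = (0 :: complex^'n)"
  proof (rule hermitian_pos_left_kernel[OF assms(1)])
    fix j
    have "(\<Sum>i\<in>UNIV. h $ i $ j * (\<chi> i. cnj (v $ i)) $ i) = cnj (\<Sum>i\<in>UNIV. h $ j $ i * v $ i)"
      by (simp add: *[of _ j])
    then show "(\<Sum>i\<in>UNIV. h $ i $ j * (\<chi> i. cnj (v $ i)) $ i) = 0"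
      using assms(2)[of j] by simp
  qed
  then show ?thesis by (simp add: vec_eq_iff)
qed

text \<open>In the splitting into \<open>Inl\<close> and \<open>Inr\<close> the matrix is block
  off-diagonal with blocks \<open>h\<close> and its transpose, so the two halves of a kernel vector
  lie in the right and left kernels of \<open>h\<close>.\<close>

lemma invertible_cmetric:
  fixes h :: "complex^'n::finite^'n"
  assumes "hermitian_pos h"
  shows "invertible (\<chi> k l. cmetric h k l)"
proof -
  let ?M = "(\<chi> k l. cmetric h k l) :: complex^('n idx)^('n idx)"
  have "x = 0" if "?M *v x = 0" for x
  proof -
    have comp: "(\<Sum>l\<in>UNIV. cmetric h k l * x $ l) = 0" for k
      using arg_cong[OF that, of "\<lambda>v. v $ k"] by (simp add: matrix_vector_mult_def)
    have "(\<chi> i. x $ Inl i) = (0 :: complex^'n)"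
      by (rule hermitian_pos_left_kernel[OF assms])
        (use comp[of "Inr _"] in \<open>simp add: sum_UNIV_Plus\<close>)
    moreover have "(\<chi> i. x $ Inr i) = (0 :: complex^'n)"
      by (rule hermitian_pos_right_kernel[OF assms])
        (use comp[of "Inl _"] in \<open>simp add: sum_UNIV_Plus\<close>)
    ultimately have "x $ c = 0" for c
      by (cases c) (simp_all add: vec_eq_iff)
    then show ?thesis by (simp add: vec_eq_iff)
  qed
  then show ?thesis
    by (simp add: invertible_left_inverse matrix_left_invertible_ker)
qed

text \<open>The inverse of an off-diagonal block matrix is off-diagonal: entry
  \<open>(Inl i, Inr l)\<close> of \<open>?N ** ?M = mat 1\<close> puts this row into the left
  kernel of \<open>h\<close>.\<close>

lemma matrix_inv_cmetric_Inl_Inl: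
  fixes h :: "complex^'n::finite^'n"
  assumes "hermitian_pos h"
  shows "matrix_inv (\<chi> k l. cmetric h k l) $ Inl i $ Inl k = 0"
proof -
  let ?M = "(\<chi> k l. cmetric h k l) :: complex^('n idx)^('n idx)"
  let ?N = "matrix_inv ?M"
  have NM: "?N ** ?M = mat 1"
    using someI_ex[OF invertible_cmetric[OF assms, unfolded invertible_def]]
    by (simp add: matrix_inv_def)
  have "(\<chi> k. ?N $ Inl i $ Inl k) = (0 :: complex^'n)"
  proof (rule hermitian_pos_left_kernel[OF assms])
    fix l
    show "(\<Sum>k\<in>UNIV. h $ k $ l * (\<chi> k. ?N $ Inl i $ Inl k) $ k) = 0"
      using arg_cong[OF NM, of "\<lambda>B. B $ Inl i $ Inr l"]
      by (simp add: matrix_matrix_mult_def sum_UNIV_Plus mat_def mult.commute)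
  qed
  then show ?thesis by (simp add: vec_eq_iff)
qed

section \<open>Wirtinger derivatives\<close>

lemma wirt_cong:
  assumes "open S" "z \<in> S" "\<And>w. w \<in> S \<Longrightarrow> f w = f' w"
  shows "wirt c f z = wirt c f' z"
proof -
  \<comment> \<open>No differentiability is assumed: \<open>frechet_derivative\<close> chooses from
    the same predicate for both functions, so the choices coincide.\<close>
  have "(f has_derivative F) (at z) \<longleftrightarrow> (f' has_derivative F) (at z)" for F
    using assms by (metis has_derivative_transform_within_open)
  then have "frechet_derivative f (at z) = frechet_derivative f' (at z)"
    by (simp add: frechet_derivative_def)
  then show ?thesis by (cases c) simp_all
qed

lemma wirt_0: "wirt c (\<lambda>w. 0) z = 0"
  by (cases c) simp_all

lemma wirt_cmult:
  assumes "f differentiable (at z)"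
  shows "wirt c (\<lambda>w. k * f w) z = k * wirt c f z"
proof -
  have "((\<lambda>w. k * f w) has_derivative (\<lambda>v. k * frechet_derivative f (at z) v)) (at z)"
    using assms by (intro has_derivative_mult_right) (simp add: frechet_derivative_works)
  then have "frechet_derivative (\<lambda>w. k * f w) (at z) = (\<lambda>v. k * frechet_derivative f (at z) v)"
    by (rule frechet_derivative_at[symmetric])
  then show ?thesis by (cases c) (simp_all add: algebra_simps diff_divide_distrib add_divide_distrib)
qed

section \<open>Wedge products with coordinate one-forms\<close>

lemma sum_fun_app: "(\<Sum>x\<in>S. f x) y = (\<Sum>x\<in>S. f x y)"
  by (induction S rule: infinite_finite_induct) auto

text \<open>Each position \<open>k\<close> of \<open>L\<close> contributes for exactly one
  direction, namely \<open>c = L ! k\<close>.\<close>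

lemma sum_dz_wedge:
  fixes F :: "'i::finite \<Rightarrow> 'i list \<Rightarrow> 'v::ab_group_add"
  shows "(\<Sum>c\<in>UNIV. dz_wedge c (F c)) L =
    (\<Sum>k<length L. if even k then F (L ! k) (take k L @ drop (Suc k) L)
       else - F (L ! k) (take k L @ drop (Suc k) L))" (is "_ = sum ?G _")
proof -
  have "(\<Sum>c\<in>UNIV. dz_wedge c (F c)) L = (\<Sum>c\<in>UNIV. \<Sum>k | k \<in> {..<length L} \<and> L ! k = c. ?G k)"
    unfolding sum_fun_app dz_wedge_def by (intro sum.cong) auto
  also have "\<dots> = sum ?G {..<length L}"
    by (rule sum.group) auto
  finally show ?thesis .
qed

lemma sum_dz_wedge_pair:
  fixes F :: "'i::finite \<Rightarrow> 'i list \<Rightarrow> 'v::ab_group_add"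
  shows "(\<Sum>c\<in>UNIV. dz_wedge c (F c)) [a, b] = F a [b] - F b [a]"
  by (simp add: sum_dz_wedge)

lemma dz_wedge_lessThan:
  "dz_wedge c f L = (\<Sum>k<length L. if L ! k = c then
     if even k then f (take k L @ drop (Suc k) L) else - f (take k L @ drop (Suc k) L) else 0)"
  unfolding dz_wedge_def by (subst sum.inter_filter[symmetric]) auto

lemma dz_wedge_pair:
  "dz_wedge c f [a, b] = (if a = c then f [b] else 0) - (if b = c then f [a] else 0)"
  by (simp add: dz_wedge_lessThan)

lemma dz_wedge_single: "dz_wedge c f [a] = (if a = c then f [] else 0)"
  by (simp add: dz_wedge_lessThan)

section \<open>The closed Kaehler form and the mixed Christoffel symbols\<close>

lemma kaehler_form_Inl_Inr: "kaehler_form h [Inl i, Inr j] = \<i> * h $ i $ j"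
proof -
  have "(\<Sum>k\<in>UNIV. \<Sum>l\<in>UNIV. if i = k then if j = l then \<i> * h $ k $ l else 0 else 0)
      = (\<Sum>k\<in>UNIV. if i = k then \<Sum>l\<in>UNIV. if j = l then \<i> * h $ k $ l else 0 else 0)"
    by (intro sum.cong) auto
  then show ?thesis
    by (simp add: kaehler_form_def dz_wedge_pair dz_wedge_single if_distrib[of "\<lambda>x. _ * x"]
        cong: if_cong)
qed

lemma kaehler_form_Inr_Inr: "kaehler_form h [Inr i, Inr j] = 0"
  by (simp add: kaehler_form_def dz_wedge_pair)

text \<open>The inverse metric leaves only \<open>d = Inr l\<close> in the sum. For
  \<open>e = Inl k\<close> the two remaining derivatives cancel by closedness of the Kaehler form;
  for \<open>e = Inr k\<close> every metric entry involved is zero.\<close>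

lemma kaehler_christoffel_Inl_Inr:
  assumes "kaehler_manifold X A g" "c \<in> A" "z \<in> chart_image c"
  shows "christoffel (g c) z (Inl i) e (Inr j) = 0"
proof -
  have pos: "hermitian_pos (g c z)"
    and closed: "closed_form A 2 (\<lambda>c z. kaehler_form (g c z))"
    using assms by (auto simp: kaehler_manifold_def)
  have sym: "wirt (Inr j) (\<lambda>w. g c w $ k $ l) z = wirt (Inr l) (\<lambda>w. g c w $ k $ j) z" for j k l
  proof -
    have "ext_d (\<lambda>w. kaehler_form (g c w)) z = 0"
      using closed assms by (simp add: closed_form_def)
    then have "ext_d (\<lambda>w. kaehler_form (g c w)) z [Inl k, Inr j, Inr l] = 0"
      by simp
    then have eq: "wirt (Inr l) (\<lambda>w. kaehler_form (g c w) [Inl k, Inr j]) z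
        = wirt (Inr j) (\<lambda>w. kaehler_form (g c w) [Inl k, Inr l]) z"
      unfolding ext_d_def sum_dz_wedge
      by (simp add: kaehler_form_Inr_Inr wirt_0 numeral_eq_Suc del: wirt.simps)
    have diff: "(\<lambda>w. g c w $ k $ l) differentiable (at z)" for l
    proof -
      have "C_k_on (Suc 0) (chart_image c) (\<lambda>w. kaehler_form (g c w) [Inl k, Inr l])"
        using closed assms(2) unfolding closed_form_def smooth_form_def smooth_on_def by blast
      then have "(\<lambda>w. \<i> * g c w $ k $ l) differentiable (at z)"
        using assms(3) by (simp add: kaehler_form_Inl_Inr)
      \<comment> \<open>Smoothness is available for the Kaehler form, hence for
        \<open>\<i> * g\<close>; the factor \<open>- \<i>\<close> recovers \<open>g\<close>.\<close>
      then have "(\<lambda>w. (- \<i>) * (\<i> * g c w $ k $ l)) differentiable (at z)"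
        by (intro differentiable_mult) auto
      then show ?thesis by (simp flip: mult.assoc)
    qed
    show ?thesis
      using eq by (simp add: kaehler_form_Inl_Inr wirt_cmult[OF diff] del: wirt.simps)
  qed
  show ?thesis
    unfolding christoffel_def
    by (cases e) (simp_all add: sum_UNIV_Plus matrix_inv_cmetric_Inl_Inl[OF pos] wirt_0 sym[of j]
        del: wirt.simps)
qed

section \<open>Operators and the holomorphic weight\<close>

text \<open>A coefficient of \<open>\<hbar>\<^sup>r y\<^sup>m\<close> has weight \<open>y_degree m + r\<close>; the variables \<open>\<bar>y\<^sup>j\<close> have weight zero,
  unlike in the usual Fedosov grading.\<close>

definition agree_below :: "nat \<Rightarrow> 'n::finite weyl \<Rightarrow> 'n weyl \<Rightarrow> bool" where
  "agree_below n a b \<longleftrightarrow> (\<forall>m r. y_degree m + r < n \<longrightarrow> fps_nth (a m) r = fps_nth (b m) r)"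

lemma agree_belowD:
  "agree_below n a b \<Longrightarrow> y_degree m + r < n \<Longrightarrow> fps_nth (a m) r = fps_nth (b m) r"
  by (simp add: agree_below_def)

lemma y_degree_plus: "y_degree (m + m') = y_degree m + y_degree m'"
  by (simp add: y_degree_def lookup_add sum.distrib)

lemma y_degree_0: "y_degree 0 = 0"
  by (simp add: y_degree_def)

lemma y_degree_single: "y_degree (Poly_Mapping.single c k) = (if isl c then k else 0)"
  by (cases c) (simp_all add: y_degree_def lookup_single when_def)

lemma diff_single_add_single:
  fixes m :: "'i \<Rightarrow>\<^sub>0 nat"
  assumes "Poly_Mapping.lookup m c \<noteq> 0"
  shows "m - Poly_Mapping.single c 1 + Poly_Mapping.single c 1 = m"
  using assms
  by (intro poly_mapping_eqI) (auto simp: lookup_add lookup_minus lookup_single when_def)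

lemma fps_nth_of_nat_mult: "fps_nth (of_nat k * f) r = of_nat k * fps_nth f r"
  by (metis fps_mult_left_const_nth fps_of_nat)

section \<open>Iterated fibre derivatives and the Wick product\<close>

lemma fps_nth_dy:
  "fps_nth (dy c a m) r = of_nat (Poly_Mapping.lookup m c + 1) * fps_nth (a (m + Poly_Mapping.single c 1)) r"
  unfolding dy_def fps_nth_of_nat_mult ..

text \<open>The factor \<open>k\<close> is chosen before \<open>a\<close>, so it is common to the
  two series being compared and its value does not matter.\<close>

lemma foldr_dy:
  "\<exists>k. \<forall>a. foldr dy cs a m = of_nat k * a (m + (\<Sum>c\<leftarrow>cs. Poly_Mapping.single c 1))"
proof (induction cs arbitrary: m)
  case Nil
  show ?case by (intro exI[of _ 1]) simp
next
  case (Cons c cs)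
  obtain k where k: "foldr dy cs a (m + Poly_Mapping.single c 1) =
      of_nat k * a (m + Poly_Mapping.single c 1 + (\<Sum>c\<leftarrow>cs. Poly_Mapping.single c 1))" for a
    using Cons.IH by blast
  show ?case
    by (intro exI[of _ "(Poly_Mapping.lookup m c + 1) * k"] allI)
      (simp only: foldr.simps comp_apply dy_def[of c] k of_nat_mult mult.assoc add.assoc list.map sum_list.Cons)
qed

lemma y_degree_sum_list_single:
  "y_degree (\<Sum>c\<leftarrow>cs. Poly_Mapping.single c 1) = length (filter isl cs)"
  by (induction cs) (auto simp: y_degree_0 y_degree_plus y_degree_single)

text \<open>Each contraction of the Wick product removes one \<open>y\<close> from the left factor and contributes
  one \<open>\<hbar>\<close>, so that the weight is additive.\<close>

lemma wick_cong:
  assumes "\<And>m1 r1 m2 r2. y_degree m1 + r1 + (y_degree m2 + r2) = y_degree m + N \<Longrightarrow>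
     fps_nth (a m1) r1 * fps_nth (b m2) r2 = fps_nth (a' m1) r1 * fps_nth (b' m2) r2"
  shows "fps_nth (wick w a b m) N = fps_nth (wick w a' b' m) N"
proof -
  have wm: "fps_nth (weyl_mult (foldr dy (map Inl is) a) (foldr dy (map Inr js) b) m) (N - k)
      = fps_nth (weyl_mult (foldr dy (map Inl is) a') (foldr dy (map Inr js) b') m) (N - k)"
    if "length is = k" "length js = k" "k \<le> N" for k "is" js
  proof -
    have "fps_nth (foldr dy (map Inl is) a r) i * fps_nth (foldr dy (map Inr js) b s) (N - k - i)
       = fps_nth (foldr dy (map Inl is) a' r) i * fps_nth (foldr dy (map Inr js) b' s) (N - k - i)"
      if "r + s = m" "i \<le> N - k" for r s i
    proof -
      let ?r = "r + (\<Sum>c\<leftarrow>map Inl is. Poly_Mapping.single c 1)"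
      let ?s = "s + (\<Sum>c\<leftarrow>map Inr js. Poly_Mapping.single c 1)"
      \<comment> \<open>The left monomial gains \<open>k\<close> holomorphic variables and the right
        one none; this balances the \<open>\<hbar>\<close>-order \<open>k\<close> taken by
        \<open>fps_X ^ k\<close>.\<close>
      have deg: "y_degree ?r = y_degree r + k" "y_degree ?s = y_degree s"
        using \<open>length is = k\<close>
        by (simp_all only: y_degree_plus y_degree_sum_list_single) (simp_all add: filter_map comp_def)
      have wt: "y_degree ?r + i + (y_degree ?s + (N - k - i)) = y_degree m + N"
        unfolding deg using that \<open>k \<le> N\<close> by (auto simp: y_degree_plus)
      obtain p where p: "foldr dy (map Inl is) x r = of_nat p * x ?r" for x
        using foldr_dy by blast
      obtain q where q: "foldr dy (map Inr js) x s = of_nat q * x ?s" for x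
        using foldr_dy by blast
      have "(of_nat p * fps_nth (x ?r) i) * (of_nat q * fps_nth (y ?s) (N - k - i)) =
          of_nat p * of_nat q * (fps_nth (x ?r) i * fps_nth (y ?s) (N - k - i))" for x y :: "'a weyl"
        by (simp add: ac_simps)
      then show ?thesis
        unfolding p q fps_nth_of_nat_mult using assms[OF wt] by presburger
    qed
    then show ?thesis
      unfolding weyl_mult_def fps_sum_nth
      by (intro sum.cong refl) (auto simp: fps_mult_nth intro!: sum.cong)
  qed
  have "fps_nth (wick_term w k a b m) N = fps_nth (wick_term w k a' b' m) N" if "k \<le> N" for k
    unfolding wick_term_def mult.assoc fps_mult_left_const_nth fps_X_power_mult_nth fps_sum_nth
    using wm[OF _ _ that] that by (auto intro!: sum.cong)
  then show ?thesis by (simp add: wick_def)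
qed

text \<open>Both factors have weight at least one wherever they are nonzero, so in total weight at
  most \<open>n\<close> each has weight below \<open>n\<close>. The bound \<open>\<le> n\<close> in
  place of \<open>< n\<close> pays for the factor \<open>1/\<hbar>\<close>.\<close>

lemma wick_form_agree:
  fixes a b :: "'n::finite weyl_form"
  assumes agree: "\<And>L. agree_below n (a L) (b L)"
    and a0: "\<And>L m. y_degree m = 0 \<Longrightarrow> a L m = 0"
    and b0: "\<And>L m. y_degree m = 0 \<Longrightarrow> b L m = 0"
    and deg: "y_degree m + r \<le> n"
  shows "fps_nth (wick_form w a a L m) r = fps_nth (wick_form w b b L m) r"
proof -
  have "fps_nth (wick w (a K) (a M) m) r = fps_nth (wick w (b K) (b M) m) r" for K M
  proof (rule wick_cong)
    fix m1 m2 :: "'n mono" and r1 r2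
    assume wt: "y_degree m1 + r1 + (y_degree m2 + r2) = y_degree m + r"
    show "fps_nth (a K m1) r1 * fps_nth (a M m2) r2 = fps_nth (b K m1) r1 * fps_nth (b M m2) r2"
    proof (cases "y_degree m1 = 0 \<or> y_degree m2 = 0")
      case True
      then show ?thesis by (auto simp: a0 b0)
    next
      case False
      then have "y_degree m1 + r1 < n" "y_degree m2 + r2 < n"
        using wt deg by linarith+
      then show ?thesis by (simp add: agree_belowD[OF agree])
    qed
  qed
  then show ?thesis
    unfolding wick_form_def sum_fun_app fps_sum_nth by (auto simp: Let_def intro!: sum.cong)
qed

text \<open>The term with indices \<open>e\<close>, \<open>b\<close> reads the coefficient at
  \<open>m\<close> with one \<open>b\<close> replaced by \<open>e\<close>. This raises
  \<open>y_degree\<close> only for holomorphic \<open>e\<close> and antiholomorphic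
  \<open>b\<close>, where the Christoffel symbol vanishes.\<close>

lemma cov_deriv_agree:
  assumes "open S" "z \<in> S"
    and agree: "\<And>w. w \<in> S \<Longrightarrow> agree_below n (s w) (s' w)"
    and mixed: "\<And>i j. christoffel g z (Inl i) c (Inr j) = 0"
    and deg: "y_degree m + r < n"
  shows "fps_nth (cov_deriv g c s z m) r = fps_nth (cov_deriv g c s' z m) r"
proof -
  have "wirt c (\<lambda>w. fps_nth (s w m) r) z = wirt c (\<lambda>w. fps_nth (s' w m) r) z"
    using assms(1,2) by (rule wirt_cong) (rule agree_belowD[OF agree deg])
  moreover have "fps_nth (fps_const (christoffel g z e c b) * ymult b (dy e (s z)) m) r =
      fps_nth (fps_const (christoffel g z e c b) * ymult b (dy e (s' z)) m) r" for e b
  proof (cases "Poly_Mapping.lookup m b = 0 \<or> (isl e \<and> \<not> isl b)")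
    case True
    then show ?thesis
      using mixed by (cases e; cases b) (auto simp: ymult_def)
  next
    case False
    then have mb: "Poly_Mapping.lookup m b \<noteq> 0" by simp
    let ?m = "m - Poly_Mapping.single b 1"
    have "?m + Poly_Mapping.single b 1 = m"
      using mb by (rule diff_single_add_single)
    then have "y_degree ?m + y_degree (Poly_Mapping.single b 1) = y_degree m"
      by (metis y_degree_plus)
    then have "y_degree (?m + Poly_Mapping.single e 1) + r < n"
      using False deg by (auto simp: y_degree_plus y_degree_single split: if_splits)
    from agree_belowD[OF agree[OF \<open>z \<in> S\<close>] this] show ?thesis
      using mb by (simp only: ymult_def fps_mult_left_const_nth fps_nth_dy if_False)
  qed
  ultimately show ?thesis
    by (simp only: cov_deriv_def fps_sub_nth fps_sum_nth fps_nth_Abs_fps)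
qed

lemma nabla_agree:
  assumes "open S" "z \<in> S"
    and "\<And>w L. w \<in> S \<Longrightarrow> agree_below n (a w L) (b w L)"
    and "\<And>c i j. christoffel g z (Inl i) c (Inr j) = 0"
    and "y_degree m + r < n"
  shows "fps_nth (nabla g a z [c, d] m) r = fps_nth (nabla g b z [c, d] m) r"
proof -
  have "fps_nth (cov_deriv g c (\<lambda>w. a w L) z m) r = fps_nth (cov_deriv g c (\<lambda>w. b w L) z m) r" for c L
    by (rule cov_deriv_agree[OF assms(1,2) _ assms(4,5)]) (rule assms(3))
  then show ?thesis by (simp add: nabla_def sum_dz_wedge_pair)
qed

section \<open>Coefficients of \<open>delta\<close> and of the gauge condition\<close>

lemma fps_nth_delta_pair:
  "fps_nth (delta a [c, d] m) r =
     of_nat (Poly_Mapping.lookup m c + 1) * fps_nth (a [d] (m + Poly_Mapping.single c 1)) r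
     - of_nat (Poly_Mapping.lookup m d + 1) * fps_nth (a [c] (m + Poly_Mapping.single d 1)) r"
  by (simp only: delta_def sum_dz_wedge_pair minus_apply fps_sub_nth fps_nth_dy)

text \<open>All contributions to this coefficient of \<open>delta10_inv a\<close> carry the same
  nonzero factor \<open>1 / (1 + y_degree m)\<close>, which can be cancelled.\<close>

lemma delta10_inv_gauge:
  assumes "delta10_inv a = 0"
  shows "(\<Sum>k\<in>UNIV. if Poly_Mapping.lookup (m + Poly_Mapping.single (Inl l) 1) (Inl k) = 0 then 0
     else a [Inl k] (m + Poly_Mapping.single (Inl l) 1 - Poly_Mapping.single (Inl k) 1)) = 0"
proof -
  let ?m = "\<lambda>k. m + Poly_Mapping.single (Inl l) 1 - Poly_Mapping.single (Inl k) 1"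
  let ?C = "fps_const (1 / of_nat (1 + y_degree m)) :: complex fps"
  have deg: "y_degree (?m k) = y_degree m"
    if "Poly_Mapping.lookup (m + Poly_Mapping.single (Inl l) 1) (Inl k) \<noteq> 0" for k
    using arg_cong[OF diff_single_add_single[OF that], of y_degree]
    by (simp add: y_degree_plus y_degree_single)
  have "0 = delta10_inv a [] (m + Poly_Mapping.single (Inl l) 1)"
    using assms by simp
  also have "\<dots> = (\<Sum>k\<in>UNIV. if Poly_Mapping.lookup (m + Poly_Mapping.single (Inl l) 1) (Inl k) = 0 then 0
     else ?C * a [Inl k] (?m k))"
    unfolding delta10_inv_def sum_fun_app ymult_def contract_def
  proof (intro sum.cong refl if_cong)
    fix k
    assume "Poly_Mapping.lookup (m + Poly_Mapping.single (Inl l) 1) (Inl k) \<noteq> 0"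
    note deg[OF this]
    moreover have "holo_form_degree [Inl k] = 1"
      by (simp add: holo_form_degree_def)
    ultimately show "fps_const (1 / of_nat (holo_form_degree [Inl k] + y_degree (?m k))) * a [Inl k] (?m k)
        = ?C * a [Inl k] (?m k)"
      by simp
  qed
  also have "\<dots> = ?C * (\<Sum>k\<in>UNIV. if Poly_Mapping.lookup (m + Poly_Mapping.single (Inl l) 1) (Inl k) = 0 then 0
     else a [Inl k] (?m k))"
    unfolding sum_distrib_left by (intro sum.cong) auto
  finally have "?C * (\<Sum>k\<in>UNIV. if Poly_Mapping.lookup (m + Poly_Mapping.single (Inl l) 1) (Inl k) = 0
     then 0 else a [Inl k] (?m k)) = 0" ..
  moreover have "?C \<noteq> 0"
    using of_nat_neq_0[where 'a = complex, of "y_degree m"] by simp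
  ultimately show ?thesis by (simp only: mult_eq_0_iff simp_thms)
qed

section \<open>Uniqueness\<close>

text \<open>Antiholomorphic components are killed by \<open>pi0\<close>. For the
  \<open>Inl l\<close> component only \<open>k = l\<close> survives in the gauge sum, and that
  summand is the coefficient itself.\<close>

lemma gauge_y_degree_0:
  assumes gauge: "delta10_inv a = 0" and pi: "pi0 a = 0" and deg: "of_degree 1 a"
    and m: "y_degree m = 0"
  shows "a L m = 0"
proof (cases "\<exists>b. L = [b]")
  case False
  then have "length L \<noteq> 1" by (cases L) auto
  then show ?thesis using deg by (simp add: of_degree_def)
next
  case True
  then obtain b where L: "L = [b]" by blast
  show ?thesis
  proof (cases b)
    case (Inr j)
    have "pi0 a L m = 0" using pi by simp
    then show ?thesis using m by (simp add: pi0_def holo_form_degree_def L Inr)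
  next
    case (Inl l)
    have m0: "Poly_Mapping.lookup m (Inl k) = 0" for k
      using m by (simp add: y_degree_def)
    have "(\<Sum>k\<in>UNIV. if k = l then a [Inl l] m else 0) =
      (\<Sum>k\<in>UNIV. if Poly_Mapping.lookup (m + Poly_Mapping.single (Inl l) 1) (Inl k) = 0 then 0
        else a [Inl k] (m + Poly_Mapping.single (Inl l) 1 - Poly_Mapping.single (Inl k) 1))"
      by (intro sum.cong) (auto simp: lookup_add lookup_single m0)
    also have "\<dots> = 0"
      using gauge by (rule delta10_inv_gauge)
    finally show ?thesis by (simp add: L Inl)
  qed
qed

text \<open>The Poincare lemma for \<open>\<delta>\<^bsup>1,0\<^esup>\<close> on one-forms: by closedness the gauge sum over \<open>k\<close> is \<open>(y_degree m + 1) / (m\<^sub>l + 1)\<close> times the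
  coefficient of \<open>dz\<^sup>l y\<^sup>m\<close>.\<close>

lemma gauge_closed_coeff_0:
  fixes d :: "'n::finite \<Rightarrow> 'n mono \<Rightarrow> complex"
  assumes gauge: "(\<Sum>k\<in>UNIV. if Poly_Mapping.lookup (m + Poly_Mapping.single (Inl l) 1) (Inl k) = 0 then 0
        else d k (m + Poly_Mapping.single (Inl l) 1 - Poly_Mapping.single (Inl k) 1)) = 0"
    and closed: "\<And>k m'. m' + Poly_Mapping.single (Inl k) 1 = m \<Longrightarrow>
        of_nat (Poly_Mapping.lookup m' (Inl k) + 1) * d l (m' + Poly_Mapping.single (Inl k) 1)
        = of_nat (Poly_Mapping.lookup m' (Inl l) + 1) * d k (m' + Poly_Mapping.single (Inl l) 1)"
  shows "d l m = 0"
proof -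
  let ?N = "of_nat (Poly_Mapping.lookup m (Inl l) + 1) :: complex"
  let ?e = "\<lambda>k. Poly_Mapping.single (Inl k) 1 :: 'n mono"
  \<comment> \<open>Closedness makes each summand a multiple of \<open>d l m\<close>; the extra 1 at
    \<open>k = l\<close> comes from the added \<open>?e l\<close>.\<close>
  have summand: "?N * (if Poly_Mapping.lookup (m + ?e l) (Inl k) = 0 then 0 else d k (m + ?e l - ?e k))
      = of_nat (Poly_Mapping.lookup m (Inl k) + (if k = l then 1 else 0)) * d l m" for k
  proof (cases "k = l")
    case True
    then show ?thesis by (simp add: lookup_add)
  next
    case False
    show ?thesis
    proof (cases "Poly_Mapping.lookup m (Inl k) = 0")
      case True
      then show ?thesis using False by (simp add: lookup_add lookup_single when_def)
    next
      case k: False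
      let ?m = "m - ?e k"
      have m: "?m + ?e k = m"
        using k by (rule diff_single_add_single)
      have swap: "m + ?e l - ?e k = ?m + ?e l"
        by (subst m[symmetric]) (simp only: add.assoc add.commute[of "?e k"], simp only: add_diff_cancel_right' flip: add.assoc)
      have "Poly_Mapping.lookup ?m (Inl k) + 1 = Poly_Mapping.lookup m (Inl k)"
        "Poly_Mapping.lookup ?m (Inl l) = Poly_Mapping.lookup m (Inl l)"
        using False k by (simp_all add: lookup_minus lookup_single when_def)
      with closed[OF m] have "of_nat (Poly_Mapping.lookup m (Inl k)) * d l m = ?N * d k (?m + ?e l)"
        by (simp only: m)
      then show ?thesis
        using False k by (simp only: swap) (simp add: lookup_add)
    qed
  qed
  have "0 = ?N * (\<Sum>k\<in>UNIV. if Poly_Mapping.lookup (m + ?e l) (Inl k) = 0 then 0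
      else d k (m + ?e l - ?e k))"
    using gauge by simp
  also have "\<dots> = of_nat (\<Sum>k\<in>UNIV. Poly_Mapping.lookup m (Inl k) + (if k = l then 1 else 0)) * d l m"
    unfolding sum_distrib_left summand of_nat_sum sum_distrib_right ..
  also have "(\<Sum>k\<in>UNIV. Poly_Mapping.lookup m (Inl k) + (if k = l then 1 else 0)) = y_degree m + 1"
    by (simp add: y_degree_def sum.distrib)
  finally show ?thesis by (simp del: of_nat_add of_nat_Suc)
qed

section \<open>Comparison of two solutions\<close>

lemma fedosov_coeff:
  assumes "fedosov_equation A g \<alpha> I" "c \<in> A" "z \<in> chart_image c"
  shows "fps_nth (delta (I c z) L m) r = fps_nth (nabla (g c) (I c) z L m) r
     + fps_nth (wick_form (omega_up (g c z)) (I c z) (I c z) L m) (Suc r)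
     + fps_nth (R_nabla (g c) z L m) r - fps_nth (\<alpha> c z L m) r"
proof -
  have "fps_to_fls (nabla (g c) (I c) z L m) - fps_to_fls (delta (I c z) L m)
        + fls_X_inv * fps_to_fls (wick_form (omega_up (g c z)) (I c z) (I c z) L m)
        + fps_to_fls (R_nabla (g c) z L m) = fps_to_fls (\<alpha> c z L m)"
    using assms unfolding fedosov_equation_def by blast
  \<comment> \<open>Multiplication by \<open>fls_X_inv\<close> lowers the order by one, so the Wick
    product enters at \<open>Suc r\<close>.\<close>
  from arg_cong[OF this, of "\<lambda>f. fls_nth f (int r)"] show ?thesis
    by (simp add: fls_X_inv_times_conv_shift nat_add_distrib algebra_simps)
qed

text \<open>Weight \<open>n\<close> of the solution enters \<open>delta\<close> in weight
  \<open>n - 1\<close>, where the other terms of the equation involve only lower weights of the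
  solution. The point \<open>z\<close> is arbitrary in the induction because \<open>nabla\<close>
  needs agreement on an open set.\<close>

lemma fedosov_agree:
  fixes A :: "('a, 'n::finite) chart set"
  assumes kaehler: "kaehler_manifold X A g" and c: "c \<in> A"
    and I: "I \<in> weyl_forms A 1" "fedosov_equation A g \<alpha> I"
      "\<And>z. z \<in> chart_image c \<Longrightarrow> delta10_inv (I c z) = 0"
      "\<And>z. z \<in> chart_image c \<Longrightarrow> pi0 (I c z) = 0"
    and J: "J \<in> weyl_forms A 1" "fedosov_equation A g \<alpha> J"
      "\<And>z. z \<in> chart_image c \<Longrightarrow> delta10_inv (J c z) = 0"
      "\<And>z. z \<in> chart_image c \<Longrightarrow> pi0 (J c z) = 0"
  shows "z \<in> chart_image c \<Longrightarrow> agree_below n (I c z L) (J c z L)"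
proof (induction n arbitrary: z L)
  case 0
  show ?case by (simp add: agree_below_def)
next
  case (Suc n)
  note z = \<open>z \<in> chart_image c\<close>
  have open_chart: "open (chart_image c)"
    using kaehler c by (auto simp: kaehler_manifold_def complex_manifold_def)
  have degI: "of_degree 1 (I c z)" and degJ: "of_degree 1 (J c z)"
    using I(1) J(1) c z by (auto simp: weyl_forms_def)
  note I0 = gauge_y_degree_0[OF I(3)[OF z] I(4)[OF z] degI]
  note J0 = gauge_y_degree_0[OF J(3)[OF z] J(4)[OF z] degJ]
  have delta: "fps_nth (delta (I c z) [a, b] m) r = fps_nth (delta (J c z) [a, b] m) r"
    if "Suc (y_degree m + r) = n" for a b m r
  proof -
    have "fps_nth (nabla (g c) (I c) z [a, b] m) r = fps_nth (nabla (g c) (J c) z [a, b] m) r"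
      by (rule nabla_agree[OF open_chart z Suc.IH kaehler_christoffel_Inl_Inr[OF kaehler c z]])
        (use that in auto)
    moreover have "fps_nth (wick_form (omega_up (g c z)) (I c z) (I c z) [a, b] m) (Suc r)
        = fps_nth (wick_form (omega_up (g c z)) (J c z) (J c z) [a, b] m) (Suc r)"
      by (rule wick_form_agree[OF Suc.IH[OF z] I0 J0]) (use that in auto)
    ultimately show ?thesis
      by (simp only: fedosov_coeff[OF I(2) c z] fedosov_coeff[OF J(2) c z])
  qed
  have "fps_nth (I c z L m) r = fps_nth (J c z L m) r" if mr: "y_degree m + r = n" for m r
  proof (cases "\<exists>b. L = [b]")
    case False
    then have "length L \<noteq> 1" by (cases L) auto
    then show ?thesis using degI degJ by (simp add: of_degree_def)
  next
    case True
    then obtain b where L: "L = [b]" by blast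
    define d where "d b m = fps_nth (I c z [b] m) r - fps_nth (J c z [b] m) r" for b m
    \<comment> \<open>This is the \<open>[Inl k, b]\<close> component of \<open>delta\<close>
      applied to the difference of the solutions.\<close>
    have closed: "of_nat (Poly_Mapping.lookup m' (Inl k) + 1) * d b (m' + Poly_Mapping.single (Inl k) 1)
        = of_nat (Poly_Mapping.lookup m' b + 1) * d (Inl k) (m' + Poly_Mapping.single b 1)"
      if m': "m' + Poly_Mapping.single (Inl k) 1 = m" for m' k b
    proof -
      have "Suc (y_degree m' + r) = n"
        using mr by (auto simp: y_degree_plus y_degree_single simp flip: m')
      from delta[OF this, of "Inl k" b] show ?thesis
        unfolding fps_nth_delta_pair d_def right_diff_distrib by (simp only: diff_eq_eq) (simp add: algebra_simps)
    qed
    have "d b m = 0"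
    proof (cases b)
      case (Inl l)
      have "d (Inl l) m = 0"
      proof (rule gauge_closed_coeff_0)
        show "(\<Sum>k\<in>UNIV. if Poly_Mapping.lookup (m + Poly_Mapping.single (Inl l) 1) (Inl k) = 0 then 0
          else d (Inl k) (m + Poly_Mapping.single (Inl l) 1 - Poly_Mapping.single (Inl k) 1)) = 0"
          (is "(\<Sum>k\<in>UNIV. if ?P k then 0 else d (Inl k) (?m k)) = 0")
        proof -
          have "(\<Sum>k\<in>UNIV. if ?P k then 0 else d (Inl k) (?m k))
             = fps_nth (\<Sum>k\<in>UNIV. if ?P k then 0 else I c z [Inl k] (?m k)) r
             - fps_nth (\<Sum>k\<in>UNIV. if ?P k then 0 else J c z [Inl k] (?m k)) r"
            unfolding fps_sum_nth sum_subtractf[symmetric] d_def by (intro sum.cong) auto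
          also have "\<dots> = 0"
            unfolding delta10_inv_gauge[OF I(3)[OF z]] delta10_inv_gauge[OF J(3)[OF z]] by simp
          finally show ?thesis .
        qed
      qed (rule closed)
      then show ?thesis by (simp add: Inl)
    next
      case (Inr j)
      show ?thesis
      proof (cases "y_degree m = 0")
        case True
        then show ?thesis by (simp add: d_def I0 J0)
      next
        case False
        \<comment> \<open>Moving one holomorphic variable from \<open>m\<close> into the form part
          leads to a coefficient of \<open>Inl k\<close> of weight \<open>n - 1\<close>, covered by
          the induction hypothesis.\<close>
        then obtain k where k: "Poly_Mapping.lookup m (Inl k) \<noteq> 0"
          by (auto simp: y_degree_def)
        define m' where "m' = m - Poly_Mapping.single (Inl k) 1"
        have m': "m' + Poly_Mapping.single (Inl k) 1 = m"
          unfolding m'_def using k by (rule diff_single_add_single)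
        have "y_degree (m' + Poly_Mapping.single b 1) + r < n"
          using mr by (auto simp: y_degree_plus y_degree_single Inr simp flip: m')
        from agree_belowD[OF Suc.IH[OF z] this]
        have "d (Inl k) (m' + Poly_Mapping.single b 1) = 0"
          by (simp add: d_def)
        with closed[OF m', of b] show ?thesis
          by (simp only: m') (simp del: of_nat_add of_nat_Suc)
      qed
    qed
    then show ?thesis by (simp add: d_def L)
  qed
  then show ?case
    using agree_belowD[OF Suc.IH[OF z]] by (auto simp: agree_below_def less_Suc_eq)
qed

theorem proposition2p22:
  fixes X :: "'a topology"
    and A :: "('a, 'n::finite) chart set"
    and g :: "('a, 'n) metric_field"
    and \<omega> :: "nat \<Rightarrow> ('a, 'n) form_field"
  assumes "kaehler_manifold X A g"
    and "\<forall>k\<ge>1. closed_form A 2 (\<omega> k)"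
  shows "\<exists>\<^sub>\<le>\<^sub>1 I. I \<in> weyl_forms A 1 \<and>
           fedosov_equation A g (formal_form \<omega>) I \<and>
           (\<forall>c\<in>A. \<forall>z\<in>chart_image c. delta10_inv (I c z) = 0) \<and>
           (\<forall>c\<in>A. \<forall>z\<in>chart_image c. pi0 (I c z) = 0)"
  unfolding Uniq_def
proof (intro allI impI, elim conjE, intro ext)
  fix I J :: "('a, 'n) weyl_field" and c z L m
  assume I: "I \<in> weyl_forms A 1" "fedosov_equation A g (formal_form \<omega>) I"
      "\<forall>c\<in>A. \<forall>z\<in>chart_image c. delta10_inv (I c z) = 0"
      "\<forall>c\<in>A. \<forall>z\<in>chart_image c. pi0 (I c z) = 0"
    and J: "J \<in> weyl_forms A 1" "fedosov_equation A g (formal_form \<omega>) J"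
      "\<forall>c\<in>A. \<forall>z\<in>chart_image c. delta10_inv (J c z) = 0"
      "\<forall>c\<in>A. \<forall>z\<in>chart_image c. pi0 (J c z) = 0"
  show "I c z L m = J c z L m"
  proof (cases "c \<in> A \<and> z \<in> chart_image c")
    case False
    \<comment> \<open>Outside the charts both fields are normalised to zero by
      \<open>weyl_forms\<close>.\<close>
    then have "I c z = 0" "J c z = 0"
      using I(1)[unfolded weyl_forms_def mem_Collect_eq, THEN conjunct1]
        J(1)[unfolded weyl_forms_def mem_Collect_eq, THEN conjunct1] by (cases c; auto)+
    then show ?thesis by simp
  next
    case True
    have "agree_below n (I c z L) (J c z L)" for n
      by (rule fedosov_agree[OF assms(1) _ I(1,2) _ _ J(1,2)]) (use True I J in auto)
    \<comment> \<open>Every coefficient has finite weight, so taking \<open>n\<close> one larger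
      reaches it.\<close>
    then show ?thesis
      by (intro fps_ext) (meson agree_belowD lessI)
  qed
qed

end
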